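(* Let $(X,\|\cdot\|)$ be a (real or complex) infinite-dimensional separable Banach space and let $A$ be a densely defined linear operator in $X$ such that each power $A^n$ ($n\in\mathbb N$) is a closed operator. Suppose there exist a set $Y\subseteq C^\infty(A):=\bigcap_{n=1}^\infty D(A^n)$ dense in $X$ and a mapping $B:Y\to Y$ such that (1) for every $f\in Y$: $ABf=f$; and (2) for every $f\in Y$ there exist $\alpha=\alpha(f)\in(0,1)$ and $c=c(f,\alpha)>0$ such that for all $n\in\mathbb N$ $$\max\left(\|A^nf\|,\|B^nf\|\right)\le c\,\alpha^n,$$ or equivalently, for every $f\in Y$: $\max\left(r(A,f),r(B,f)\right)<1$, where $r(A,f):=\limsup_{n\to\infty}\|A^nf\|^{1/n}$ and $r(B,f):=\limsup_{n\to\infty}\|B^nf\|^{1/n}$. Then the operator $A$ is chaotic.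
   Context: Operators may be unbounded; $D(\cdot)$ denotes the domain of an operator, and $A^0:=I$. The mapping $B:Y\to Y$ is not assumed linear or continuous, and $Y$ is only a set (not assumed to be a subspace). A linear operator $A$ in a Banach space $X$ is called hypercyclic if there is a nonzero vector $f\in\bigcap_{n=0}^\infty D(A^n)$ (a hypercyclic vector) whose orbit $\{A^nf\}_{n\ge 0}$ is dense in $X$. A vector $f$ is a periodic point of $A$ if for some $N\in\mathbb N=\{1,2,\dots\}$ one has $f\in D(A^N)$ and $A^Nf=f$. The operator $A$ is called chaotic if it is hypercyclic and its set of periodic points is dense in $X$. *)

theory Defs
  imports "HOL-Analysis.Analysis"
begin

text \<open>
  Real and complex Banach spaces are treated uniformly: the type \<open>'a\<close> carries the real
  Banach space structure, and \<open>smul\<close> is the multiplication by scalars from \<open>'k\<close>.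
  A \<open>real_normed_field\<close> has a multiplicative norm, so by the Gelfand-Mazur theorem it is
  isometrically isomorphic to \<open>real\<close> or to \<open>complex\<close>; for \<open>'k = real\<close> the definition
  below forces \<open>smul\<close> to be \<open>scaleR\<close>.
\<close>

definition normed_space_over :: "('k::real_normed_field \<Rightarrow> 'a::real_normed_vector \<Rightarrow> 'a) \<Rightarrow> bool"
  where "normed_space_over smul \<longleftrightarrow>
    vector_space smul \<and>
    (\<forall>r x. smul (of_real r) x = r *\<^sub>R x) \<and>
    (\<forall>c x. norm (smul c x) = norm c * norm x)"

definition infinite_dimensional :: "('k::field \<Rightarrow> 'a::ab_group_add \<Rightarrow> 'a) \<Rightarrow> bool"
  where "infinite_dimensional smul \<longleftrightarrow> \<not> (\<exists>S. finite S \<and> module.span smul S = UNIV)"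

text \<open>
  A possibly unbounded operator is a pair of a domain \<open>D\<close> and a function \<open>A\<close>; the values
  of \<open>A\<close> outside \<open>D\<close> are irrelevant. On its domain \<open>pow_dom D A n\<close>, the \<open>n\<close>-th power of
  the operator is the iterate \<open>A ^^ n\<close>.
\<close>

definition linear_operator ::
    "('k::field \<Rightarrow> 'a::ab_group_add \<Rightarrow> 'a) \<Rightarrow> 'a set \<Rightarrow> ('a \<Rightarrow> 'a) \<Rightarrow> bool"
  where "linear_operator smul D A \<longleftrightarrow>
    module.subspace smul D \<and>
    (\<forall>x\<in>D. \<forall>y\<in>D. A (x + y) = A x + A y) \<and>
    (\<forall>c. \<forall>x\<in>D. A (smul c x) = smul c (A x))"

definition closed_operator :: "'a::topological_space set \<Rightarrow> ('a \<Rightarrow> 'a) \<Rightarrow> bool"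
  where "closed_operator D A \<longleftrightarrow> closed {(x, A x) | x. x \<in> D}"

primrec pow_dom :: "'a set \<Rightarrow> ('a \<Rightarrow> 'a) \<Rightarrow> nat \<Rightarrow> 'a set"
  where
    "pow_dom D A 0 = UNIV"
  | "pow_dom D A (Suc n) = {x \<in> D. A x \<in> pow_dom D A n}"

definition C_infinity :: "'a set \<Rightarrow> ('a \<Rightarrow> 'a) \<Rightarrow> 'a set"
  where "C_infinity D A = (\<Inter>n\<in>{1..}. pow_dom D A n)"

definition hypercyclic_vector ::
    "'a::{zero, topological_space} set \<Rightarrow> ('a \<Rightarrow> 'a) \<Rightarrow> 'a \<Rightarrow> bool"
  where "hypercyclic_vector D A f \<longleftrightarrow>
    f \<noteq> 0 \<and> f \<in> (\<Inter>n. pow_dom D A n) \<and> closure {(A ^^ n) f | n. True} = UNIV"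

definition hypercyclic :: "'a::{zero, topological_space} set \<Rightarrow> ('a \<Rightarrow> 'a) \<Rightarrow> bool"
  where "hypercyclic D A \<longleftrightarrow> (\<exists>f. hypercyclic_vector D A f)"

definition periodic_point :: "'a set \<Rightarrow> ('a \<Rightarrow> 'a) \<Rightarrow> 'a \<Rightarrow> bool"
  where "periodic_point D A f \<longleftrightarrow> (\<exists>N\<ge>1. f \<in> pow_dom D A N \<and> (A ^^ N) f = f)"

definition chaotic :: "'a::{zero, topological_space} set \<Rightarrow> ('a \<Rightarrow> 'a) \<Rightarrow> bool"
  where "chaotic D A \<longleftrightarrow> hypercyclic D A \<and> closure {f. periodic_point D A f} = UNIV"

text \<open>The upper limit is taken in the extended reals, as it may be infinite.\<close>

definition local_radius :: "('a::real_normed_vector \<Rightarrow> 'a) \<Rightarrow> 'a \<Rightarrow> ereal"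
  where "local_radius T f = limsup (\<lambda>n. ereal (root n (norm ((T ^^ n) f))))"

end

theory Submission
  imports Defs
begin

text \<open>
  Series built from forward orbits \<open>A\<^sup>n f\<close> and backward orbits \<open>B\<^sup>n f\<close> converge geometrically,
  and the closedness of the powers of \<open>A\<close> allows them to be applied term by term. For
  \<open>f \<in> Y\<close>, the two-sided sum \<open>f + (\<Sum>k\<ge>1. A\<^sup>k\<^sup>N f + B\<^sup>k\<^sup>N f)\<close> is a fixed point of \<open>A\<^sup>N\<close> and tends to
  \<open>f\<close> as \<open>N\<close> grows. If \<open>(y\<^sub>k)\<close> visits every member of a countable dense subset of \<open>Y\<close> infinitely
  often and the gaps of \<open>n(k)\<close> grow fast enough, then \<open>\<Sum>k. B\<^sup>n\<^sup>(\<^sup>k\<^sup>) y\<^sub>k\<close> is hypercyclic, because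
  applying \<open>A\<^sup>n\<^sup>(\<^sup>j\<^sup>)\<close> gives \<open>y\<^sub>j\<close> up to a small error.
\<close>

section \<open>Geometric decay of orbits and local spectral radii\<close>

lemma local_radius_less_1_iff:
  "local_radius T f < 1 \<longleftrightarrow>
    (\<exists>\<alpha>::real. 0 < \<alpha> \<and> \<alpha> < 1 \<and> (\<exists>c>0. \<forall>n\<ge>1. norm ((T ^^ n) f) \<le> c * \<alpha> ^ n))"
proof
  assume "local_radius T f < 1"
  \<comment> \<open>The maximum with 0 makes the intermediate value positive, so that dividing by
    powers of \<open>\<alpha>\<close> is legitimate below; lying between 0 and 1, it is also
    finite.\<close>
  then have "max 0 (local_radius T f) < 1" by simp
  then obtain z where z: "max 0 (local_radius T f) < z" "z < 1"
    using dense by blast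
  define \<alpha> where "\<alpha> = real_of_ereal z"
  have z_eq: "z = ereal \<alpha>" unfolding \<alpha>_def using z by (cases z) auto
  have \<alpha>: "0 < \<alpha>" "\<alpha> < 1" using z z_eq by auto
  have "local_radius T f < ereal \<alpha>" using z z_eq by simp
  then have "\<forall>\<^sub>F n in sequentially. ereal (root n (norm ((T ^^ n) f))) < ereal \<alpha>"
    unfolding local_radius_def by (rule Limsup_lessD)
  then obtain N where N: "\<And>n. n \<ge> N \<Longrightarrow> root n (norm ((T ^^ n) f)) < \<alpha>"
    by (auto simp: eventually_sequentially)
  \<comment> \<open>Index 0 is excluded because \<open>root 0\<close> is constantly 0, so the norm
    cannot be recovered from its root there.\<close>
  have tail: "norm ((T ^^ n) f) \<le> \<alpha> ^ n" if "n \<ge> N" "n \<ge> 1" for n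
  proof -
    have "norm ((T ^^ n) f) = root n (norm ((T ^^ n) f)) ^ n"
      using that by simp
    also have "\<dots> \<le> \<alpha> ^ n"
      using N[OF that(1)] by (intro power_mono real_root_ge_zero) auto
    finally show ?thesis .
  qed
  \<comment> \<open>The sum absorbs the finitely many indices below \<open>N\<close>; the summand 1
    covers the tail and makes \<open>c\<close> positive.\<close>
  define c where "c = 1 + (\<Sum>n<N. norm ((T ^^ n) f) / \<alpha> ^ n)"
  have nonneg: "0 \<le> (\<Sum>n<N. norm ((T ^^ n) f) / \<alpha> ^ n)"
    using \<alpha> by (intro sum_nonneg) auto
  have "norm ((T ^^ n) f) \<le> c * \<alpha> ^ n" if "n \<ge> 1" for n
  proof (cases "n < N")
    case True
    then have "norm ((T ^^ n) f) / \<alpha> ^ n \<le> (\<Sum>n<N. norm ((T ^^ n) f) / \<alpha> ^ n)"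
      using \<alpha> by (intro member_le_sum) auto
    then have "norm ((T ^^ n) f) / \<alpha> ^ n \<le> c" by (simp add: c_def)
    then show ?thesis using \<alpha> by (simp add: divide_le_eq)
  next
    case False
    have "\<alpha> ^ n * 1 \<le> \<alpha> ^ n * c" using nonneg \<alpha> by (intro mult_left_mono) (auto simp: c_def)
    then show ?thesis using tail[of n] False that by (simp add: mult.commute)
  qed
  moreover have "c > 0" using nonneg by (simp add: c_def)
  ultimately show "\<exists>\<alpha>::real. 0 < \<alpha> \<and> \<alpha> < 1 \<and> (\<exists>c>0. \<forall>n\<ge>1. norm ((T ^^ n) f) \<le> c * \<alpha> ^ n)"
    using \<alpha> by blast
next
  assume "\<exists>\<alpha>::real. 0 < \<alpha> \<and> \<alpha> < 1 \<and> (\<exists>c>0. \<forall>n\<ge>1. norm ((T ^^ n) f) \<le> c * \<alpha> ^ n)"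
  then obtain \<alpha> c :: real where \<alpha>: "0 < \<alpha>" "\<alpha> < 1" and c: "c > 0"
    and le: "\<And>n. n \<ge> 1 \<Longrightarrow> norm ((T ^^ n) f) \<le> c * \<alpha> ^ n" by blast
  have root_le: "root n (norm ((T ^^ n) f)) \<le> root n c * \<alpha>" if "n \<ge> 1" for n
  proof -
    have "root n (norm ((T ^^ n) f)) \<le> root n (c * \<alpha> ^ n)"
      using le that by simp
    also have "\<dots> = root n c * \<alpha>"
      using that \<alpha> by (simp add: real_root_mult real_root_power_cancel)
    finally show ?thesis .
  qed
  \<comment> \<open>The n-th roots of a positive constant tend to 1, so \<open>c\<close> does not
    affect the upper limit.\<close>
  have "(\<lambda>n. root n c * \<alpha>) \<longlonglongrightarrow> 1 * \<alpha>"
    by (intro tendsto_mult LIMSEQ_root_const c tendsto_const)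
  then have "limsup (\<lambda>n. ereal (root n c * \<alpha>)) = ereal \<alpha>"
    by (intro lim_imp_Limsup) auto
  moreover have "local_radius T f \<le> limsup (\<lambda>n. ereal (root n c * \<alpha>))"
    unfolding local_radius_def
    by (intro Limsup_mono eventually_sequentiallyI[of 1]) (simp add: root_le)
  ultimately have "local_radius T f \<le> ereal \<alpha>" by simp
  also have "\<dots> < 1" using \<alpha> by simp
  finally show "local_radius T f < 1" .
qed

text \<open>The larger rate and the larger constant serve both sequences. This reduces the
  equivalence of the two decay conditions to one orbit at a time.\<close>

lemma common_geometric_bound_iff:
  fixes a b :: "nat \<Rightarrow> real"
  shows "(\<exists>\<alpha>::real. 0 < \<alpha> \<and> \<alpha> < 1 \<and> (\<exists>c>0. \<forall>n\<ge>1. max (a n) (b n) \<le> c * \<alpha> ^ n)) \<longleftrightarrow>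
    (\<exists>\<alpha>::real. 0 < \<alpha> \<and> \<alpha> < 1 \<and> (\<exists>c>0. \<forall>n\<ge>1. a n \<le> c * \<alpha> ^ n)) \<and>
    (\<exists>\<alpha>::real. 0 < \<alpha> \<and> \<alpha> < 1 \<and> (\<exists>c>0. \<forall>n\<ge>1. b n \<le> c * \<alpha> ^ n))" (is "?L \<longleftrightarrow> ?R")
proof
  assume ?L
  then obtain \<alpha> c :: real where "0 < \<alpha>" "\<alpha> < 1" "c > 0"
    "\<And>n. n \<ge> 1 \<Longrightarrow> a n \<le> c * \<alpha> ^ n" "\<And>n. n \<ge> 1 \<Longrightarrow> b n \<le> c * \<alpha> ^ n" by auto
  then show ?R by blast
next
  assume ?R
  then obtain \<alpha> c \<beta> d :: real where \<alpha>: "0 < \<alpha>" "\<alpha> < 1" "c > 0" "\<And>n. n \<ge> 1 \<Longrightarrow> a n \<le> c * \<alpha> ^ n"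
    and \<beta>: "0 < \<beta>" "\<beta> < 1" "d > 0" "\<And>n. n \<ge> 1 \<Longrightarrow> b n \<le> d * \<beta> ^ n" by blast
  have "c * \<alpha> ^ n \<le> max c d * max \<alpha> \<beta> ^ n" "d * \<beta> ^ n \<le> max c d * max \<alpha> \<beta> ^ n" for n
    using \<alpha> \<beta> by (auto intro!: mult_mono power_mono simp: le_max_iff_disj)
  then have "max (a n) (b n) \<le> max c d * max \<alpha> \<beta> ^ n" if "n \<ge> 1" for n
    using \<alpha>(4)[OF that] \<beta>(4)[OF that] by (meson max.bounded_iff order_trans)
  then show ?L using \<alpha> \<beta> by (intro exI[of _ "max \<alpha> \<beta>"] conjI exI[of _ "max c d"]) auto
qed

section \<open>Countable dense subsets and recurrent enumerations\<close>

lemma countable_dense_subset: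
  fixes Y :: "'a::metric_space set"
  assumes "separable_space (euclidean :: 'a topology)" and Y: "closure Y = UNIV"
  obtains C where "countable C" "C \<subseteq> Y" "closure C = UNIV"
proof -
  obtain S :: "'a set" where S: "countable S" "closure S = UNIV"
    using assms(1) by (auto simp: separable_space_def)
  have "\<exists>y\<in>Y. dist y s < 1 / Suc n" for s and n :: nat
    using Y closure_approachable[of s Y] by (metis UNIV_I of_nat_0_less_iff zero_less_Suc zero_less_divide_1_iff)
  then obtain p where p: "\<And>s n. p s n \<in> Y" "\<And>s n. dist (p s n) s < 1 / Suc n"
    by metis
  \<comment> \<open>Each point of \<open>S\<close> is replaced by a sequence in \<open>Y\<close>
    converging to it, so countability and density both survive.\<close>
  define C where "C = (\<lambda>(s, n). p s n) ` (S \<times> UNIV)"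
  have "x \<in> closure C" for x
    unfolding closure_approachable
  proof (intro allI impI)
    fix e :: real assume "e > 0"
    then obtain n where n: "1 / Suc n < e / 2" using nat_approx_posE[of "e / 2"] by auto
    obtain s where s: "s \<in> S" "dist s x < e / 2"
      using S(2) \<open>e > 0\<close> closure_approachable[of x S] by (metis UNIV_I half_gt_zero)
    have "dist (p s n) x \<le> dist (p s n) s + dist s x" by (rule dist_triangle)
    also have "\<dots> < e" using p(2)[of s n] n s by linarith
    finally show "\<exists>y\<in>C. dist y x < e" using s by (auto simp: C_def)
  qed
  moreover have "countable C" unfolding C_def using S by auto
  moreover have "C \<subseteq> Y" using p by (auto simp: C_def)
  ultimately show ?thesis using that by blast
qed

text \<open>Enumerating pairs and ignoring the second component repeats each member of a countable
  dense set at arbitrarily large indices. The recurrence matters because the hypercyclic vector will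
  approximate \<open>y j\<close> only up to an error that vanishes as \<open>j\<close>
  grows.\<close>

lemma recurrent_dense_sequence:
  fixes Y :: "'a::metric_space set"
  assumes "separable_space (euclidean :: 'a topology)" and "closure Y = UNIV"
  obtains y :: "nat \<Rightarrow> 'a" where "range y \<subseteq> Y"
    "\<And>x e m. e > 0 \<Longrightarrow> \<exists>j\<ge>m. dist (y j) x < e"
proof -
  obtain C where C: "countable C" "C \<subseteq> Y" "closure C = UNIV"
    using countable_dense_subset[OF assms] .
  then have "C \<noteq> {}" by auto
  define y where "y = (\<lambda>j. from_nat_into C (fst (prod_decode j)))"
  have "\<exists>j\<ge>m. dist (y j) x < e" if e: "e > 0" for x e m
  proof -
    obtain s where s: "s \<in> C" "dist s x < e"
      using C(3) e closure_approachable[of x C] by (metis UNIV_I)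
    have "y (prod_encode (to_nat_on C s, m)) = s"
      using s C by (simp add: y_def)
    then show ?thesis using s le_prod_encode_2 by metis
  qed
  moreover have "range y \<subseteq> Y"
    using C from_nat_into[OF \<open>C \<noteq> {}\<close>] by (auto simp: y_def)
  ultimately show ?thesis using that by blast
qed

section \<open>Closed powers applied term by term to series\<close>

lemma closed_operator_seqD:
  fixes T :: "'a::metric_space \<Rightarrow> 'a"
  assumes "closed_operator E T" "\<And>n. x n \<in> E" "x \<longlonglongrightarrow> a" "(\<lambda>n. T (x n)) \<longlonglongrightarrow> b"
  shows "a \<in> E \<and> T a = b"
proof -
  have "(\<lambda>n. (x n, T (x n))) \<longlonglongrightarrow> (a, b)"
    using assms(3,4) by (rule tendsto_Pair)
  with assms(1,2) have "(a, b) \<in> {(x, T x) | x. x \<in> E}"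
    unfolding closed_operator_def by (elim closed_sequentially) auto
  then show ?thesis by auto
qed

text \<open>Linearity enters through additivity, since the constructions form sums and limits; this
  treats real and complex scalars at once.\<close>

locale additive_operator =
  fixes D :: "'a::banach set" and A :: "'a \<Rightarrow> 'a"
  assumes zero_dom: "0 \<in> D"
    and add_dom: "\<And>x y. x \<in> D \<Longrightarrow> y \<in> D \<Longrightarrow> x + y \<in> D"
    and add: "\<And>x y. x \<in> D \<Longrightarrow> y \<in> D \<Longrightarrow> A (x + y) = A x + A y"
    and closed_pow: "\<And>n. n \<ge> 1 \<Longrightarrow> closed_operator (pow_dom D A n) (A ^^ n)"
begin

lemma map_zero: "A 0 = 0"
  using add[of 0 0] zero_dom by simp

lemma pow_zero: "(A ^^ n) 0 = 0"
  by (induction n) (auto simp: map_zero)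

lemma zero_pow_dom: "0 \<in> pow_dom D A n"
  by (induction n) (auto simp: zero_dom map_zero)

lemma pow_add:
  assumes "x \<in> pow_dom D A n" "y \<in> pow_dom D A n"
  shows "x + y \<in> pow_dom D A n \<and> (A ^^ n) (x + y) = (A ^^ n) x + (A ^^ n) y"
  using assms
proof (induction n arbitrary: x y)
  case (Suc n)
  \<comment> \<open>\<open>pow_dom\<close> recurses by applying \<open>A\<close> first, so the
    iterate has to be unfolded at the inner end as well.\<close>
  then show ?case by (auto simp: add_dom add funpow_Suc_right simp del: funpow.simps)
qed auto

lemma pow_sum:
  fixes u :: "nat \<Rightarrow> 'a"
  assumes "\<And>k. u k \<in> pow_dom D A n"
  shows "(\<Sum>k<N. u k) \<in> pow_dom D A n \<and> (A ^^ n) (\<Sum>k<N. u k) = (\<Sum>k<N. (A ^^ n) (u k))"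
  by (induction N) (use assms in \<open>auto simp: zero_pow_dom pow_zero pow_add\<close>)

text \<open>Closedness takes the place of continuity: the partial sums and their images both
  converge, so the pair of limits lies in the graph. For \<open>n = 0\<close>, which
  \<open>closed_pow\<close> does not cover, the power is the identity and limits are unique.\<close>

lemma pow_sums:
  assumes "\<And>k. u k \<in> pow_dom D A n" and "u sums f" and "(\<lambda>k. (A ^^ n) (u k)) sums g"
  shows "f \<in> pow_dom D A n \<and> (A ^^ n) f = g"
proof (cases "n = 0")
  case True
  then show ?thesis using assms(2,3) sums_unique2 by auto
next
  case False
  then have "n \<ge> 1" by simp
  from closed_pow[OF this] show ?thesis
    by (rule closed_operator_seqD[where x = "\<lambda>N. \<Sum>k<N. u k"])
      (use assms pow_sum[OF assms(1)] in \<open>auto simp: sums_def\<close>)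
qed

end

section \<open>Forward and backward orbits of points of \<open>Y\<close>\<close>

locale right_inverse_orbits = additive_operator D A
  for D :: "'a::banach set" and A :: "'a \<Rightarrow> 'a" +
  fixes Y :: "'a set" and B :: "'a \<Rightarrow> 'a"
  assumes Y_smooth: "Y \<subseteq> C_infinity D A"
    and Y_dense: "closure Y = UNIV"
    and B_maps: "B \<in> Y \<rightarrow> Y"
    and right_inverse: "\<And>f. f \<in> Y \<Longrightarrow> A (B f) = f"
    and geometric: "\<And>f. f \<in> Y \<Longrightarrow> \<exists>\<alpha>::real. 0 < \<alpha> \<and> \<alpha> < 1 \<and> (\<exists>c>0. \<forall>n\<ge>1.
             max (norm ((A ^^ n) f)) (norm ((B ^^ n) f)) \<le> c * \<alpha> ^ n)"
begin

lemma Y_pow_dom: "f \<in> Y \<Longrightarrow> f \<in> pow_dom D A n"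
  using Y_smooth by (cases "n = 0") (auto simp: C_infinity_def Suc_le_eq)

text \<open>\<open>Y\<close> is not assumed invariant under \<open>A\<close>; the domain of the n-th
  power is reached because \<open>f\<close> admits \<open>m + n\<close> applications of
  \<open>A\<close>.\<close>

lemma pow_pow_dom:
  assumes "f \<in> Y"
  shows "(A ^^ m) f \<in> pow_dom D A n"
proof -
  have "x \<in> pow_dom D A (m + n) \<Longrightarrow> (A ^^ m) x \<in> pow_dom D A n" for x
    by (induction m arbitrary: x) (auto simp: funpow_Suc_right simp del: funpow.simps)
  then show ?thesis using Y_pow_dom assms by blast
qed

lemma B_pow_Y: "f \<in> Y \<Longrightarrow> (B ^^ n) f \<in> Y"
  using B_maps by (induction n) auto

text \<open>Each \<open>A\<close> cancels the outermost \<open>B\<close>, since all iterates of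
  \<open>B\<close> on \<open>f\<close> stay in \<open>Y\<close>, where \<open>right_inverse\<close>
  applies.\<close>

lemma A_pow_B_pow_le:
  assumes "f \<in> Y" "m \<le> n"
  shows "(A ^^ m) ((B ^^ n) f) = (B ^^ (n - m)) f"
  using assms(2)
proof (induction m)
  case (Suc m)
  then have "n - m = Suc (n - Suc m)" by simp
  then show ?case using Suc right_inverse[OF B_pow_Y[OF assms(1)]] by simp
qed simp

lemma A_pow_B_pow_ge:
  assumes "f \<in> Y" "n \<le> m"
  shows "(A ^^ m) ((B ^^ n) f) = (A ^^ (m - n)) f"
proof -
  have "(A ^^ m) ((B ^^ n) f) = (A ^^ (m - n)) ((A ^^ n) ((B ^^ n) f))"
    using assms(2) by (simp flip: comp_apply[of "A ^^ (m - n)"] funpow_add)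
  then show ?thesis using A_pow_B_pow_le[OF assms(1), of n n] by simp
qed

section \<open>Density of periodic points\<close>

lemma periodic_point_near:
  assumes f: "f \<in> Y" and e: "e > 0"
  shows "\<exists>g. periodic_point D A g \<and> dist g f < e"
proof -
  obtain \<alpha> c :: real where \<alpha>: "0 < \<alpha>" "\<alpha> < 1" and c: "c > 0"
    and A_le: "\<And>n. n \<ge> 1 \<Longrightarrow> norm ((A ^^ n) f) \<le> c * \<alpha> ^ n"
    and B_le: "\<And>n. n \<ge> 1 \<Longrightarrow> norm ((B ^^ n) f) \<le> c * \<alpha> ^ n"
    using geometric[OF f] by auto
  \<comment> \<open>The forward and the backward tail will each have norm at most
    \<open>c * \<alpha> ^ N / (1 - \<alpha>)\<close>; the period \<open>N\<close> is chosen to make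
    their total less than \<open>e\<close>.\<close>
  have "(\<lambda>n. 2 * c / (1 - \<alpha>) * \<alpha> ^ n) \<longlonglongrightarrow> 2 * c / (1 - \<alpha>) * 0"
    using \<alpha> by (intro tendsto_mult tendsto_const LIMSEQ_realpow_zero) auto
  then have "\<forall>\<^sub>F n in sequentially. 2 * c / (1 - \<alpha>) * \<alpha> ^ n < e"
    using e by (intro order_tendstoD(2)) auto
  then obtain N0 where N0: "\<And>n. n \<ge> N0 \<Longrightarrow> 2 * c / (1 - \<alpha>) * \<alpha> ^ n < e"
    by (auto simp: eventually_sequentially)
  define N where "N = Suc N0"
  have N: "N \<ge> 1" "2 * c / (1 - \<alpha>) * \<alpha> ^ N < e" using N0[of N] by (auto simp: N_def)
  define a where "a = (\<lambda>k. (A ^^ (k * N)) f)"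
  define b where "b = (\<lambda>k. (B ^^ (k * N)) f)"
  \<comment> \<open>Since \<open>N \<ge> 1\<close>, the exponent \<open>Suc k * N\<close> is at
    least \<open>N + k\<close>. The weaker ratio \<open>\<alpha>\<close> gives a simple geometric
    majorant that keeps the factor \<open>\<alpha> ^ N\<close>.\<close>
  have pow_le: "c * \<alpha> ^ (Suc k * N) \<le> c * \<alpha> ^ N * \<alpha> ^ k" for k
  proof -
    have "\<alpha> ^ (Suc k * N) \<le> \<alpha> ^ (N + k)"
      using \<alpha> N(1) by (intro power_decreasing) auto
    then show ?thesis using c by (simp add: power_add mult.assoc)
  qed
  have a_le: "norm (a (Suc k)) \<le> c * \<alpha> ^ N * \<alpha> ^ k"
    and b_le: "norm (b (Suc k)) \<le> c * \<alpha> ^ N * \<alpha> ^ k" for k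
    using A_le[of "Suc k * N"] B_le[of "Suc k * N"] pow_le[of k] N(1)
    unfolding a_def b_def by (auto intro: order_trans)
  have geo: "(\<lambda>k. c * \<alpha> ^ N * \<alpha> ^ k) sums (c * \<alpha> ^ N * (1 / (1 - \<alpha>)))"
    using \<alpha> by (intro sums_mult geometric_sums) auto
  have sum_a: "summable (\<lambda>k. a (Suc k))" and sum_b: "summable (\<lambda>k. b (Suc k))"
    using a_le b_le by (auto intro: summable_comparison_test' sums_summable[OF geo])
  define p where "p = (\<Sum>k. a (Suc k))"
  define q where "q = (\<Sum>k. b (Suc k))"
  have p: "(\<lambda>k. a (Suc k)) sums p" and q: "(\<lambda>k. b (Suc k)) sums q"
    using sum_a sum_b by (auto simp: p_def q_def summable_sums)
  have a0: "a 0 = f" and b0: "b 0 = f" by (auto simp: a_def b_def)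
  \<comment> \<open>One sum is written in two ways, with \<open>f\<close> attached to the forward
    half or to the backward half. The N-th power of \<open>A\<close> shifts \<open>a\<close> up and
    \<open>b\<close> down, which turns the first arrangement into the second, so the sum is
    fixed.\<close>
  have "a sums (p + f)" using p sums_Suc_iff[of a p] by (simp add: a0)
  then have s1: "(\<lambda>k. a k + b (Suc k)) sums (p + f + q)" using q by (rule sums_add)
  have "b sums (q + f)" using q sums_Suc_iff[of b q] by (simp add: b0)
  then have "(\<lambda>k. a (Suc k) + b k) sums (p + (q + f))" using p sums_add by blast
  moreover have dom: "a k \<in> pow_dom D A N" "b (Suc k) \<in> pow_dom D A N" for k
    unfolding a_def b_def using f by (simp_all add: pow_pow_dom Y_pow_dom B_pow_Y del: mult_Suc)
  have "(A ^^ N) (a k + b (Suc k)) = a (Suc k) + b k" for k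
  proof -
    have "(A ^^ N) (a k) = a (Suc k)"
      by (simp add: a_def funpow_add)
    moreover have "(A ^^ N) (b (Suc k)) = b k"
      unfolding b_def by (subst A_pow_B_pow_le[OF f]) auto
    ultimately show ?thesis using pow_add dom by metis
  qed
  ultimately have s2: "(\<lambda>k. (A ^^ N) (a k + b (Suc k))) sums (p + f + q)"
    by (simp add: add_ac)
  have "p + f + q \<in> pow_dom D A N \<and> (A ^^ N) (p + f + q) = p + f + q"
    by (rule pow_sums[OF _ s1 s2]) (use dom pow_add in blast)
  then have "periodic_point D A (p + f + q)"
    using N by (auto simp: periodic_point_def)
  moreover have "dist (p + f + q) f < e"
  proof -
    have "norm p \<le> c * \<alpha> ^ N * (1 / (1 - \<alpha>))" "norm q \<le> c * \<alpha> ^ N * (1 / (1 - \<alpha>))"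
      using norm_suminf_le[OF a_le sums_summable[OF geo]] norm_suminf_le[OF b_le sums_summable[OF geo]]
      unfolding p_def q_def sums_unique[OF geo] by auto
    then have "norm (p + q) \<le> 2 * (c * \<alpha> ^ N * (1 / (1 - \<alpha>)))"
      using norm_triangle_ineq[of p q] by linarith
    also have "\<dots> = 2 * c / (1 - \<alpha>) * \<alpha> ^ N" by simp
    finally have "norm (p + q) \<le> 2 * c / (1 - \<alpha>) * \<alpha> ^ N" .
    then show ?thesis using N(2) by (simp add: dist_norm algebra_simps)
  qed
  ultimately show ?thesis by blast
qed

lemma dense_periodic_points: "closure {f. periodic_point D A f} = UNIV"
proof -
  have "Y \<subseteq> closure {f. periodic_point D A f}"
    using periodic_point_near by (auto simp: closure_approachable)
  then show ?thesis using Y_dense closure_minimal[OF _ closed_closure] by blast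
qed

section \<open>Construction of a hypercyclic vector\<close>

lemma orbits_eventually_small:
  assumes f: "f \<in> Y" and e: "e > 0"
  shows "\<forall>\<^sub>F n in sequentially. norm ((A ^^ n) f) \<le> e \<and> norm ((B ^^ n) f) \<le> e"
proof -
  obtain \<alpha> c :: real where \<alpha>: "0 < \<alpha>" "\<alpha> < 1"
    and le: "\<And>n. n \<ge> 1 \<Longrightarrow> max (norm ((A ^^ n) f)) (norm ((B ^^ n) f)) \<le> c * \<alpha> ^ n"
    using geometric[OF f] by blast
  have "(\<lambda>n. c * \<alpha> ^ n) \<longlonglongrightarrow> c * 0"
    using \<alpha> by (intro tendsto_mult tendsto_const LIMSEQ_realpow_zero) auto
  then have "\<forall>\<^sub>F n in sequentially. c * \<alpha> ^ n < e"
    using e by (intro order_tendstoD(2)) auto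
  with eventually_ge_at_top[of 1] show ?thesis
    by eventually_elim (use le in fastforce)
qed

text \<open>\<open>L j\<close> is the gap to be left before the j-th exponent. The bound on
  \<open>A\<close> is uniform over the finitely many \<open>k \<le> j\<close> and divided by
  \<open>j + 1\<close>, so that all earlier terms together contribute at most
  \<open>(1/2) ^ j\<close>; the bound on \<open>B\<close> controls the later terms.\<close>

lemma gap_sequence:
  assumes "range y \<subseteq> Y"
  obtains L :: "nat \<Rightarrow> nat" where "\<And>j. L j \<ge> 1"
    "\<And>j k n. k \<le> j \<Longrightarrow> n \<ge> L j \<Longrightarrow> norm ((A ^^ n) (y k)) \<le> (1/2) ^ j / (real j + 1)"
    "\<And>j n. n \<ge> L j \<Longrightarrow> norm ((B ^^ n) (y j)) \<le> (1/2) ^ j"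
proof -
  have "\<exists>l\<ge>1. \<forall>n\<ge>l. \<forall>k\<in>{..j}. norm ((A ^^ n) (y k)) \<le> (1/2) ^ j / (real j + 1) \<and>
      norm ((B ^^ n) (y k)) \<le> (1/2) ^ j / (real j + 1)" for j
  proof -
    have "\<forall>\<^sub>F n in sequentially. \<forall>k\<in>{..j}. norm ((A ^^ n) (y k)) \<le> (1/2) ^ j / (real j + 1) \<and>
        norm ((B ^^ n) (y k)) \<le> (1/2) ^ j / (real j + 1)"
      using assms by (intro eventually_ball_finite finite_atMost ballI orbits_eventually_small)
        (auto intro: divide_pos_pos)
    then obtain l0 where "\<forall>n\<ge>l0. \<forall>k\<in>{..j}. norm ((A ^^ n) (y k)) \<le> (1/2) ^ j / (real j + 1) \<and>
        norm ((B ^^ n) (y k)) \<le> (1/2) ^ j / (real j + 1)"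
      unfolding eventually_sequentially by blast
    then show ?thesis by (intro exI[of _ "Suc l0"]) auto
  qed
  then obtain L where L: "\<And>j. L j \<ge> 1"
    "\<And>j n k. n \<ge> L j \<Longrightarrow> k \<le> j \<Longrightarrow> norm ((A ^^ n) (y k)) \<le> (1/2) ^ j / (real j + 1) \<and>
      norm ((B ^^ n) (y k)) \<le> (1/2) ^ j / (real j + 1)"
    unfolding Ball_def atMost_iff by metis
  have le: "(1/2) ^ j / (real j + 1) \<le> (1/2::real) ^ j" for j
    by (simp add: divide_le_eq)
  show ?thesis
    using L le order_trans by (intro that[of L]) blast+
qed

lemma dense_orbit:
  assumes "separable_space (euclidean :: 'a topology)"
  obtains f where "f \<in> (\<Inter>n. pow_dom D A n)" "closure {(A ^^ n) f | n. True} = UNIV"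
proof -
  obtain y :: "nat \<Rightarrow> 'a" where y: "range y \<subseteq> Y" "\<And>x e m. e > 0 \<Longrightarrow> \<exists>j\<ge>m. dist (y j) x < e"
    using recurrent_dense_sequence[OF assms Y_dense] by blast
  have yY: "y k \<in> Y" for k using y(1) by auto
  obtain L where L: "\<And>j. L j \<ge> 1"
    "\<And>j k n. k \<le> j \<Longrightarrow> n \<ge> L j \<Longrightarrow> norm ((A ^^ n) (y k)) \<le> (1/2) ^ j / (real j + 1)"
    "\<And>j n. n \<ge> L j \<Longrightarrow> norm ((B ^^ n) (y j)) \<le> (1/2) ^ j"
    using gap_sequence[OF y(1)] by blast
  \<comment> \<open>With partial sums as exponents, \<open>t j\<close> exceeds every earlier
    \<open>t k\<close>, not just the preceding one, by at least \<open>L j\<close>.\<close>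
  define t where "t = (\<lambda>j. \<Sum>i\<le>j. L i)"
  have gap: "t k + L j \<le> t j" if "k < j" for k j
  proof -
    have "t k + L j = (\<Sum>i\<in>insert j {..k}. L i)" using that by (simp add: t_def)
    also have "\<dots> \<le> t j" unfolding t_def using that by (intro sum_mono2) auto
    finally show ?thesis .
  qed
  \<comment> \<open>This makes the tail estimate available for every power \<open>m\<close>, not
    only for the exponents \<open>t j\<close>, as membership of \<open>f\<close> in all the domains
    requires.\<close>
  have le_t: "m \<le> t m" for m
  proof (induction m)
    case (Suc m)
    then show ?case using gap[of m "Suc m"] L(1)[of "Suc m"] by simp
  qed simp
  define u where "u = (\<lambda>k. (B ^^ t k) (y k))"
  \<comment> \<open>On a later term \<open>A\<close> only removes part of the powers of
    \<open>B\<close>; at least \<open>L k\<close> of them remain.\<close>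
  have tail: "norm ((A ^^ m) (u k)) \<le> (1/2) ^ k" if "m \<le> t j" "j < k" for m j k
  proof -
    have "t j + L k \<le> t k" using gap that by blast
    then show ?thesis unfolding u_def
      using that A_pow_B_pow_le[OF yY, of m "t k"] L(3)[of k "t k - m"] by simp
  qed
  have half: "summable (\<lambda>k. (1/2::real) ^ k)" by (intro summable_geometric) auto
  have sum_Au: "summable (\<lambda>k. (A ^^ m) (u k))" for m
    using half by (rule summable_comparison_test'[where N = "Suc m"]) (simp add: tail[OF le_t] Suc_le_eq)
  define f where "f = (\<Sum>k. u k)"
  have f_pow: "f \<in> pow_dom D A m \<and> (A ^^ m) f = (\<Sum>k. (A ^^ m) (u k))" for m
  proof (rule pow_sums)
    show "u k \<in> pow_dom D A m" for k unfolding u_def using yY by (intro Y_pow_dom B_pow_Y)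
    show "u sums f" using sum_Au[of 0] by (simp add: f_def summable_sums)
    show "(\<lambda>k. (A ^^ m) (u k)) sums (\<Sum>k. (A ^^ m) (u k))" using sum_Au by (rule summable_sums)
  qed
  have near: "norm ((A ^^ t j) f - y j) \<le> 2 * (1/2) ^ j" for j
  proof -
    let ?v = "\<lambda>k. (A ^^ t j) (u k)"
    \<comment> \<open>The series splits into the later terms, the term \<open>y j\<close> itself and
      the earlier terms. The later ones are dominated by the geometric tail beyond \<open>j\<close>,
      whose sum is \<open>(1/2) ^ j\<close>.\<close>
    have "(A ^^ t j) f = (\<Sum>k. ?v (k + Suc j)) + (\<Sum>k<Suc j. ?v k)"
      using f_pow suminf_split_initial_segment[OF sum_Au, of "t j" "Suc j"] by simp
    moreover have "?v j = y j" unfolding u_def using A_pow_B_pow_le[OF yY, of "t j" "t j"] by simp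
    ultimately have eq: "(A ^^ t j) f - y j = (\<Sum>k. ?v (k + Suc j)) + (\<Sum>k<j. ?v k)" by simp
    have geo: "(\<lambda>k. (1/2) ^ Suc j * (1/2::real) ^ k) sums ((1/2) ^ Suc j * (1 / (1 - 1/2)))"
      by (intro sums_mult geometric_sums) auto
    have "norm (?v (k + Suc j)) \<le> (1/2) ^ Suc j * (1/2) ^ k" for k
      using tail[of "t j" j "k + Suc j"] by (simp add: power_add mult_ac)
    from norm_suminf_le[OF this sums_summable[OF geo]]
    have 1: "norm (\<Sum>k. ?v (k + Suc j)) \<le> (1/2) ^ j"
      unfolding sums_unique[OF geo, symmetric] by simp
    \<comment> \<open>On an earlier term all powers of \<open>B\<close> are cancelled, and at least
      \<open>L j\<close> powers of \<open>A\<close> are left to act on \<open>y k\<close>.\<close>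
    have "norm (?v k) \<le> (1/2) ^ j / (real j + 1)" if "k < j" for k
      unfolding u_def using gap[OF that] A_pow_B_pow_ge[OF yY, of "t k" "t j" k]
        L(2)[of k j "t j - t k"] that by simp
    then have "norm (\<Sum>k<j. ?v k) \<le> (\<Sum>k<j. (1/2) ^ j / (real j + 1))"
      by (intro sum_norm_le) auto
    also have "\<dots> \<le> (1/2) ^ j" by (simp add: divide_simps)
    finally show ?thesis unfolding eq using 1 norm_triangle_ineq[of "\<Sum>k. ?v (k + Suc j)" "\<Sum>k<j. ?v k"]
      by linarith
  qed
  have "x \<in> closure {(A ^^ n) f | n. True}" for x
    unfolding closure_approachable
  proof (intro allI impI)
    fix e :: real assume e: "e > 0"
    have "(\<lambda>j. 2 * (1/2::real) ^ j) \<longlonglongrightarrow> 2 * 0"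
      by (intro tendsto_mult tendsto_const LIMSEQ_realpow_zero) auto
    from order_tendstoD(2)[OF this, of "e / 2"]
    have "\<forall>\<^sub>F j in sequentially. 2 * (1/2::real) ^ j < e / 2"
      using e by simp
    then obtain m where m: "\<And>j. j \<ge> m \<Longrightarrow> 2 * (1/2::real) ^ j < e / 2"
      by (auto simp: eventually_sequentially)
    \<comment> \<open>Recurrence supplies an index that is good for \<open>x\<close> and also late
      enough for the error in \<open>near\<close> to be small.\<close>
    obtain j where j: "j \<ge> m" "dist (y j) x < e / 2" using y(2)[of "e / 2" m x] e by auto
    have "dist ((A ^^ t j) f) x \<le> dist ((A ^^ t j) f) (y j) + dist (y j) x" by (rule dist_triangle)
    also have "\<dots> < e" using near[of j] m[OF j(1)] j(2) by (simp add: dist_norm)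
    finally show "\<exists>z\<in>{(A ^^ n) f | n. True}. dist z x < e" by blast
  qed
  then show ?thesis using that f_pow by blast
qed

section \<open>Chaos from the two density results\<close>

lemma chaotic_if_separable:
  assumes "separable_space (euclidean :: 'a topology)" and "(UNIV :: 'a set) \<noteq> {0}"
  shows "chaotic D A"
proof -
  obtain f where f: "f \<in> (\<Inter>n. pow_dom D A n)" "closure {(A ^^ n) f | n. True} = UNIV"
    using dense_orbit[OF assms(1)] .
  \<comment> \<open>The orbit of 0 is the closed set \<open>{0}\<close>, which is not dense in a
    nontrivial space.\<close>
  have "f \<noteq> 0"
  proof
    assume "f = 0"
    then have "{(A ^^ n) f | n. True} = {0}" using pow_zero by auto
    with f(2) assms(2) show False by simp
  qed
  with f have "hypercyclic D A" by (auto simp: hypercyclic_def hypercyclic_vector_def)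
  then show ?thesis using dense_periodic_points by (simp add: chaotic_def)
qed

end

theorem theorem3p2:
  fixes smul :: "'k::real_normed_field \<Rightarrow> 'a::banach \<Rightarrow> 'a"
    and D Y :: "'a set"
    and A B :: "'a \<Rightarrow> 'a"
  assumes "normed_space_over smul"
    and "infinite_dimensional smul"
    and "separable_space (euclidean :: 'a topology)"
    and "linear_operator smul D A"
    and "closure D = UNIV"
    and "\<And>n. n \<ge> 1 \<Longrightarrow> closed_operator (pow_dom D A n) (A ^^ n)"
    and "Y \<subseteq> C_infinity D A"
    and "closure Y = UNIV"
    and "B \<in> Y \<rightarrow> Y"
    and "\<And>f. f \<in> Y \<Longrightarrow> A (B f) = f"
  shows "((\<forall>f\<in>Y. \<exists>\<alpha>::real. 0 < \<alpha> \<and> \<alpha> < 1 \<and> (\<exists>c>0. \<forall>n\<ge>1.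
             max (norm ((A ^^ n) f)) (norm ((B ^^ n) f)) \<le> c * \<alpha> ^ n))
          \<longleftrightarrow> (\<forall>f\<in>Y. max (local_radius A f) (local_radius B f) < 1))
       \<and> ((\<forall>f\<in>Y. \<exists>\<alpha>::real. 0 < \<alpha> \<and> \<alpha> < 1 \<and> (\<exists>c>0. \<forall>n\<ge>1.
             max (norm ((A ^^ n) f)) (norm ((B ^^ n) f)) \<le> c * \<alpha> ^ n))
          \<longrightarrow> chaotic D A)"
proof (intro conjI impI)
  let ?geometric = "\<lambda>f. \<exists>\<alpha>::real. 0 < \<alpha> \<and> \<alpha> < 1 \<and> (\<exists>c>0. \<forall>n\<ge>1.
             max (norm ((A ^^ n) f)) (norm ((B ^^ n) f)) \<le> c * \<alpha> ^ n)"
  show "(\<forall>f\<in>Y. ?geometric f) \<longleftrightarrow> (\<forall>f\<in>Y. max (local_radius A f) (local_radius B f) < 1)"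
    unfolding common_geometric_bound_iff local_radius_less_1_iff[symmetric] by simp
  assume geometric: "\<forall>f\<in>Y. ?geometric f"
  interpret vector_space smul
    using assms(1) by (simp add: normed_space_over_def)
  have D: "subspace D" and add: "\<And>x y. x \<in> D \<Longrightarrow> y \<in> D \<Longrightarrow> A (x + y) = A x + A y"
    using assms(4) by (auto simp: linear_operator_def)
  interpret right_inverse_orbits D A Y B
    by unfold_locales
      (use assms(6-10) D add geometric in \<open>auto intro: subspace_0 subspace_add\<close>)
  \<comment> \<open>The zero space is spanned by the empty set, so infinite dimension rules it
    out.\<close>
  have "(UNIV :: 'a set) \<noteq> {0}"
    using assms(2) span_empty unfolding infinite_dimensional_def by (metis finite.emptyI)
  with assms(3) show "chaotic D A" by (rule chaotic_if_separable)
qed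

end
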